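(* For every integer $n\ge 1$ define $$S(n)=\sum_{k\ge1}\sum_{N\ge1} f(k,N)\,g(n-k,N).$$ Then, as formal power series in $q$, $$\sum_{n\ge1}S(n)q^n=\sum_{n\ge1}\left(\frac{1}{(q;q)_{\infty}}-\frac{1}{(q;q)_n}\right)\sum_{i=1}^{n}\frac{q^{i}}{1-q^i}=\sum_{n\ge1}\Big(p_2(n)-n\,p(n)-\tfrac{1}{2}N_2(n)\Big)q^n.$$
   Context: $(a;q)_n=\prod_{k=0}^{n-1}(1-aq^k)$ and $(a;q)_\infty=\prod_{k\ge0}(1-aq^k)$. $p(n)$ is the number of (unrestricted) partitions of $n$, with $p(0)=1$. $p(m,n)$ is the number of partitions of $n$ with exactly $m$ parts, and $p_2(n)=\sum_{m}m^2p(m,n)$. The rank of a partition is its largest part minus its number of parts; $N(m,n)$ is the number of partitions of $n$ with rank $m$, and $N_2(n)=\sum_{m\in\mathbb{Z}}m^2N(m,n)$ is the second Atkin–Garvan rank moment. For integers $k\ge0$, $N\ge1$, $f(k,N)$ is $p(k)$ minus the number of partitions of $k$ all of whose parts are $\le N$ (equivalently, the coefficient of $q^k$ in $1/(q;q)_\infty-1/(q;q)_N$). For integers $m$ and $N\ge1$, $g(m,N)$ is the number of positive divisors $d\le N$ of $m$ when $m\ge1$, and $g(m,N)=0$ when $m\le 0$ (equivalently, $g(m,N)$ is the coefficient of $q^m$ in $\sum_{i=1}^N q^i/(1-q^i)$). *)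

theory Defs
  imports
    "HOL-Analysis.Analysis"
    "HOL-Library.Multiset"
    "HOL-Computational_Algebra.Formal_Power_Series"
begin

definition qpoch :: "'a::comm_ring_1 \<Rightarrow> 'a \<Rightarrow> nat \<Rightarrow> 'a" where
  "qpoch a q n = (\<Prod>k<n. 1 - a * q ^ k)"

text \<open>On formal power series the limit is taken in the \<open>q\<close>-adic metric of
  \<^theory>\<open>HOL-Computational_Algebra.Formal_Power_Series\<close>.\<close>

definition qpoch_inf :: "'a::{t2_space, comm_ring_1} \<Rightarrow> 'a \<Rightarrow> 'a" where
  "qpoch_inf a q = prodinf (\<lambda>k. 1 - a * q ^ k)"

definition partitions :: "nat \<Rightarrow> nat multiset set" where
  "partitions n = {P. 0 \<notin># P \<and> sum_mset P = n}"

definition num_partitions :: "nat \<Rightarrow> nat" where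
  "num_partitions n = card (partitions n)"

definition num_partitions_parts :: "nat \<Rightarrow> nat \<Rightarrow> nat" where
  "num_partitions_parts m n = card {P \<in> partitions n. size P = m}"

definition parts_moment2 :: "nat \<Rightarrow> nat" where
  "parts_moment2 n = (\<Sum>\<^sub>\<infinity>m\<in>UNIV. m\<^sup>2 * num_partitions_parts m n)"

text \<open>Inserting \<open>0\<close> only affects the empty partition, which thereby gets rank \<open>0\<close>.\<close>

definition largest_part :: "nat multiset \<Rightarrow> nat" where
  "largest_part P = Max (insert 0 (set_mset P))"

definition partition_rank :: "nat multiset \<Rightarrow> int" where
  "partition_rank P = int (largest_part P) - int (size P)"

definition num_partitions_rank :: "int \<Rightarrow> nat \<Rightarrow> nat" where
  "num_partitions_rank m n = card {P \<in> partitions n. partition_rank P = m}"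

definition rank_moment2 :: "nat \<Rightarrow> int" where
  "rank_moment2 n = (\<Sum>\<^sub>\<infinity>m\<in>UNIV. m\<^sup>2 * int (num_partitions_rank m n))"

definition f_coeff :: "nat \<Rightarrow> nat \<Rightarrow> int" where
  "f_coeff k N = int (num_partitions k) - int (card {P \<in> partitions k. \<forall>x\<in>#P. x \<le> N})"

definition g_coeff :: "int \<Rightarrow> nat \<Rightarrow> nat" where
  "g_coeff m N = (if m \<ge> 1 then card {d::nat. 1 \<le> d \<and> d \<le> N \<and> int d dvd m} else 0)"

definition S_sum :: "nat \<Rightarrow> int" where
  "S_sum n = (\<Sum>\<^sub>\<infinity>k\<in>{1..}. \<Sum>\<^sub>\<infinity>N\<in>{1..}. f_coeff k N * int (g_coeff (int n - int k) N))"

text \<open>The infinite sums above have finite support, so they are honest sums rather than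
  the default value \<open>0\<close> of a divergent one.\<close>

lemma partition_bounds:
  assumes "P \<in> partitions n"
  shows "size P \<le> n" and "x \<in># P \<Longrightarrow> x \<le> n"
proof -
  have "size P \<le> sum_mset P" if "0 \<notin># P" for P :: "nat multiset"
    using that by (induction P) auto
  with assms show "size P \<le> n" by (auto simp: partitions_def)
  show "x \<le> n" if "x \<in># P"
    using assms that by (auto simp: partitions_def dest: multi_member_split)
qed

lemma finite_partitions: "finite (partitions n)"
proof (rule finite_subset)
  show "partitions n \<subseteq> mset ` {xs. set xs \<subseteq> {..n} \<and> length xs \<le> n}"
  proof
    fix P assume P: "P \<in> partitions n"
    obtain xs where "P = mset xs" by (metis ex_mset)
    with partition_bounds[OF P] show "P \<in> mset ` {xs. set xs \<subseteq> {..n} \<and> length xs \<le> n}"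
      by auto
  qed
qed (simp add: finite_lists_length_le)

lemma finite_support_parts: "finite {m. num_partitions_parts m n \<noteq> 0}"
proof (rule finite_subset)
  show "{m. num_partitions_parts m n \<noteq> 0} \<subseteq> size ` partitions n"
    by (auto simp: num_partitions_parts_def card_eq_0_iff)
qed (simp add: finite_partitions)

lemma finite_support_rank: "finite {m. num_partitions_rank m n \<noteq> 0}"
proof (rule finite_subset)
  show "{m. num_partitions_rank m n \<noteq> 0} \<subseteq> partition_rank ` partitions n"
    by (auto simp: num_partitions_rank_def card_eq_0_iff)
qed (simp add: finite_partitions)

lemma f_coeff_eq_0: "k \<le> N \<Longrightarrow> f_coeff k N = 0"
proof -
  assume "k \<le> N"
  hence "{P \<in> partitions k. \<forall>x\<in>#P. x \<le> N} = partitions k"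
    using partition_bounds(2) order_trans by blast
  thus ?thesis by (simp add: f_coeff_def num_partitions_def)
qed

lemma g_coeff_eq_0: "n \<le> k \<Longrightarrow> g_coeff (int n - int k) N = 0"
  by (simp add: g_coeff_def)

end

theory Submission
  imports Defs
begin

text \<open>
  Write \<open>L(P)\<close> and \<open>s(P)\<close> for the largest part and the number of parts of \<open>P\<close>. Since \<open>L\<close> and \<open>s\<close> are
  equidistributed on the partitions of \<open>n\<close>, expanding the square \<open>(L - s)\<^sup>2\<close> turns
  \<open>p\<^sub>2(n) - n p(n) - N\<^sub>2(n) / 2\<close> into the sum of \<open>L(P) s(P) - n\<close> over all partitions \<open>P\<close> of \<open>n\<close>, that is,
  the sum of the gaps \<open>L(P) - i\<close> over all parts \<open>i\<close> of \<open>P\<close>. This counts the quadruples \<open>(P, i, j, N)\<close>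
  where \<open>j\<close> is between \<open>1\<close> and the multiplicity of \<open>i\<close> in \<open>P\<close> and \<open>i \<le> N < L(P)\<close>. Removing \<open>j\<close> copies
  of \<open>i\<close> from \<open>P\<close> leaves a partition \<open>Q\<close> of \<open>n - i j\<close> with the same largest part, so the quadruples
  correspond to a number \<open>N\<close>, a partition \<open>Q\<close> of some \<open>k\<close> with \<open>L(Q) > N\<close> (counted by \<open>f(k, N)\<close>) and a
  factorisation \<open>n - k = i j\<close> with \<open>i \<le> N\<close> (counted by \<open>g(n - k, N)\<close>).
\<close>

unbundle no vec_syntax and fps_syntax

section \<open>Equidistribution of the largest part and the number of parts\<close>

lemma largest_part_le_iff: "largest_part P \<le> m \<longleftrightarrow> (\<forall>x\<in>#P. x \<le> m)"
  by (simp add: largest_part_def)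

lemma largest_part_in: "0 < largest_part P \<Longrightarrow> largest_part P \<in># P"
  using Max_in[of "insert 0 (set_mset P)"] by (auto simp: largest_part_def)

lemma largest_part_eqI: "m \<in># P \<Longrightarrow> (\<And>x. x \<in># P \<Longrightarrow> x \<le> m) \<Longrightarrow> largest_part P = m"
  by (auto simp: largest_part_def intro!: Max_eqI)

text \<open>One copy of the largest part is removed. Conversely, adding \<open>m\<close> to parts
  that are all at most \<open>m\<close> makes \<open>m\<close> the largest part.\<close>

lemma card_largest_part_recursion:
  assumes "0 < m" "m \<le> n"
  shows "card {P \<in> partitions n. largest_part P = m} =
    card {P \<in> partitions (n - m). largest_part P \<le> m}"
proof (rule bij_betw_same_card)
  show "bij_betw (\<lambda>P. P - {#m#}) {P \<in> partitions n. largest_part P = m}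
      {P \<in> partitions (n - m). largest_part P \<le> m}"
  proof (rule bij_betw_byWitness[where f' = "add_mset m"], goal_cases)
    case 1
    show ?case using assms largest_part_in by auto
  next
    case 2
    show ?case by simp
  next
    case 3
    have "P - {#m#} \<in> partitions (n - m) \<and> largest_part (P - {#m#}) \<le> m"
      if P: "P \<in> partitions n" "largest_part P = m" for P
    proof -
      have "m \<in># P"
        using P assms largest_part_in by auto
      then obtain Q where Q: "P = add_mset m Q" by (metis mset_add)
      have "\<forall>x\<in>#P. x \<le> m" using P(2) largest_part_le_iff by blast
      then show ?thesis using P(1) unfolding Q by (auto simp: partitions_def largest_part_le_iff)
    qed
    then show ?case by auto
  next
    case 4
    show ?case
      using assms by (auto simp: partitions_def largest_part_le_iff intro!: largest_part_eqI)
  qed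
qed

text \<open>The first column of the Ferrers diagram, which has \<open>m\<close> cells, is removed.
  The recursion has the same shape as the one for the largest part, which is what the
  equidistribution rests on.\<close>

lemma card_size_recursion:
  assumes "0 < m" "m \<le> n"
  shows "card {P \<in> partitions n. size P = m} =
    card {P \<in> partitions (n - m). size P \<le> m}"
proof (rule bij_betw_same_card)
  define f :: "nat multiset \<Rightarrow> nat multiset"
    where "f P = filter_mset (\<lambda>x. x \<noteq> 0) (image_mset (\<lambda>x. x - 1) P)" for P
  \<comment> \<open>The column of \<open>m\<close> cells is put back: every part grows by one, and
    new parts \<open>1\<close> fill up to \<open>m\<close> parts.\<close>
  define g :: "nat multiset \<Rightarrow> nat multiset"
    where "g Q = image_mset Suc Q + replicate_mset (m - size Q) 1" for Q
  \<comment> \<open>Stated with \<open>size P\<close> in place of the fixed \<open>m\<close>,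
    because the induction changes the size. For \<open>size P = m\<close> the last conjunct is
    \<open>g (f P) = P\<close>.\<close>
  have f: "sum_mset (f P) + size P = sum_mset P \<and> size (f P) \<le> size P \<and>
      image_mset Suc (f P) + replicate_mset (size P - size (f P)) 1 = P"
    if "0 \<notin># P" for P
    using that
  proof (induction P)
    case (add x P)
    \<comment> \<open>A part \<open>1\<close> vanishes under \<open>f\<close> and comes back through
      the padding; every other part survives.\<close>
    then show ?case by (cases "x = 1") (auto simp: f_def Suc_diff_le)
  qed (simp add: f_def)
  have fg: "f (g Q) = Q" if "0 \<notin># Q" for Q
  proof -
    have "f (image_mset Suc Q) = Q"
      using that by (induction Q) (auto simp: f_def)
    moreover have "f (replicate_mset k 1) = {#}" for k
      by (auto simp: f_def)
    moreover have "f (A + B) = f A + f B" for A B by (simp add: f_def)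
    ultimately show ?thesis by (simp only: g_def add_0_right)
  qed
  have gf: "g (f P) = P" if "0 \<notin># P" "size P = m" for P
    using f[OF that(1)] that(2) by (simp add: g_def)
  have sum_Suc: "sum_mset (image_mset Suc Q) = sum_mset Q + size Q" for Q
    by (induction Q) auto
  have f_in: "f P \<in> partitions (n - m) \<and> size (f P) \<le> m" if "P \<in> partitions n" "size P = m" for P
  proof -
    have "0 \<notin># P" "sum_mset P = n" using that(1) by (auto simp: partitions_def)
    moreover have "0 \<notin># f P" by (simp add: f_def)
    ultimately show ?thesis using f[of P] that(2) by (auto simp: partitions_def)
  qed
  have g_in: "g Q \<in> partitions n \<and> size (g Q) = m" if "Q \<in> partitions (n - m)" "size Q \<le> m" for Q
    using that assms by (auto simp: partitions_def sum_Suc g_def in_replicate_mset)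
  show "bij_betw f {P \<in> partitions n. size P = m} {P \<in> partitions (n - m). size P \<le> m}"
  proof (rule bij_betw_byWitness[where f' = g], goal_cases)
    case 1
    show ?case using gf by (simp add: partitions_def)
  next
    case 2
    show ?case using fg by (simp add: partitions_def)
  next
    case 3
    show ?case using f_in by blast
  next
    case 4
    show ?case using g_in by blast
  qed
qed

lemma card_le_conv_sum:
  assumes "finite A"
  shows "card {x \<in> A. h x \<le> (m::nat)} = (\<Sum>i\<le>m. card {x \<in> A. h x = i})"
proof -
  have "{x \<in> A. h x \<le> m} = (\<Union>i\<le>m. {x \<in> A. h x = i})" by auto
  then show ?thesis using assms by (simp only:) (rule card_UN_disjoint, auto)
qed

text \<open>Instead of conjugating diagrams, induction on \<open>n\<close>: for
  \<open>0 < m \<le> n\<close> both counts reduce to partitions of \<open>n - m\<close> whose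
  statistic is at most \<open>m\<close>, and the induction hypothesis applies to each value of the
  statistic.\<close>

lemma card_size_eq_card_largest_part:
  "card {P \<in> partitions n. size P = m} = card {P \<in> partitions n. largest_part P = m}"
proof (induction n arbitrary: m rule: less_induct)
  case (less n)
  consider "m = 0" | "n < m" | "0 < m" "m \<le> n" by linarith
  then show ?case
  proof cases
    case 1
    have "size P = 0 \<longleftrightarrow> largest_part P = 0" if "P \<in> partitions n" for P
    proof
      show "size P = 0 \<Longrightarrow> largest_part P = 0" by (simp add: largest_part_def)
      assume "largest_part P = 0"
      then have "x = 0" if "x \<in># P" for x
        using that largest_part_le_iff[of P 0] by simp
      with \<open>P \<in> partitions n\<close> have "set_mset P = {}" by (auto simp: partitions_def)
      then show "size P = 0" by simp
    qed
    with 1 show ?thesis by (metis (mono_tags, lifting) Collect_cong)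
  next
    case 2
    have "size P < m" "largest_part P < m" if "P \<in> partitions n" for P
      using partition_bounds[OF that] largest_part_le_iff[of P n] 2 by auto
    then have "{P \<in> partitions n. size P = m} = {}" "{P \<in> partitions n. largest_part P = m} = {}"
      by auto
    then show ?thesis by (simp only:)
  next
    case 3
    then show ?thesis
      using less[of "n - m"]
      by (simp add: card_size_recursion card_largest_part_recursion card_le_conv_sum finite_partitions)
  qed
qed

section \<open>Moments as finite sums over partitions\<close>

lemma sum_conv_sum_fibres:
  fixes h :: "'a \<Rightarrow> 'b" and w :: "'b \<Rightarrow> 'c::comm_semiring_1"
  assumes "finite A" "finite B" "h ` A \<subseteq> B"
  shows "(\<Sum>x\<in>A. w (h x)) = (\<Sum>y\<in>B. w y * of_nat (card {x \<in> A. h x = y}))"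
  using sum.group[OF assms, of "\<lambda>x. w (h x)"]
  by (simp add: mult.commute)

text \<open>Only the finitely many values of \<open>h\<close> on \<open>A\<close> contribute, so a
  moment defined by an infinite sum becomes a finite sum over partitions.\<close>

lemma infsum_fibres:
  fixes h :: "'a \<Rightarrow> 'b" and w :: "'b \<Rightarrow> 'c::{comm_semiring_1, t2_space}"
  assumes "finite A"
  shows "(\<Sum>\<^sub>\<infinity>y\<in>UNIV. w y * of_nat (card {x \<in> A. h x = y})) = (\<Sum>x\<in>A. w (h x))"
proof -
  have "(\<Sum>\<^sub>\<infinity>y\<in>UNIV. w y * of_nat (card {x \<in> A. h x = y}))
      = (\<Sum>\<^sub>\<infinity>y\<in>h ` A. w y * of_nat (card {x \<in> A. h x = y}))"
  proof (rule infsum_cong_neutral)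
    fix y assume "y \<in> UNIV - h ` A"
    then have "{x \<in> A. h x = y} = {}" by auto
    then show "w y * of_nat (card {x \<in> A. h x = y}) = 0" by (simp only: card.empty of_nat_0 mult_zero_right)
  qed auto
  then show ?thesis using sum_conv_sum_fibres[OF assms, of "h ` A" h w] assms by simp
qed

lemma parts_moment2_size: "parts_moment2 n = (\<Sum>P\<in>partitions n. (size P)\<^sup>2)"
  using infsum_fibres[OF finite_partitions, of "\<lambda>m::nat. m\<^sup>2" n size]
  by (simp add: parts_moment2_def num_partitions_parts_def)

lemma parts_moment2_largest_part: "parts_moment2 n = (\<Sum>P\<in>partitions n. (largest_part P)\<^sup>2)"
  using infsum_fibres[OF finite_partitions, of "\<lambda>m::nat. m\<^sup>2" n largest_part]
  by (simp add: parts_moment2_def num_partitions_parts_def card_size_eq_card_largest_part)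

lemma rank_moment2_eq: "rank_moment2 n = (\<Sum>P\<in>partitions n. (partition_rank P)\<^sup>2)"
  using infsum_fibres[OF finite_partitions, of "\<lambda>m::int. m\<^sup>2" n partition_rank]
  by (simp add: rank_moment2_def num_partitions_rank_def)

lemma rank_moment2_conv_parts_moment2:
  "rank_moment2 n = 2 * int (parts_moment2 n) - 2 * (\<Sum>P\<in>partitions n. int (largest_part P * size P))"
proof -
  have "rank_moment2 n = (\<Sum>P\<in>partitions n. int ((largest_part P)\<^sup>2) + int ((size P)\<^sup>2)
      - 2 * int (largest_part P * size P))"
    by (simp add: rank_moment2_eq partition_rank_def power2_diff mult.assoc)
  \<comment> \<open>By equidistribution, both squares sum to the same moment.\<close>
  also have "\<dots> = int (parts_moment2 n) + int (parts_moment2 n)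
      - 2 * (\<Sum>P\<in>partitions n. int (largest_part P * size P))"
    unfolding sum_subtractf sum.distrib sum_distrib_left
    by (simp only: parts_moment2_size flip: of_nat_sum parts_moment2_largest_part)
  finally show ?thesis by simp
qed


section \<open>The double count behind S(n)\<close>

lemma largest_part_add_replicate:
  assumes "i < largest_part Q \<or> i < largest_part (Q + replicate_mset j i)"
  shows "largest_part (Q + replicate_mset j i) = largest_part Q"
proof (rule antisym)
  show *: "largest_part Q \<le> largest_part (Q + replicate_mset j i)"
    using largest_part_le_iff[of "Q + replicate_mset j i" "largest_part (Q + replicate_mset j i)"]
    by (simp add: largest_part_le_iff)
  \<comment> \<open>Either disjunct yields this bound. The first is at hand when copies of
    \<open>i\<close> are added to \<open>Q\<close>, the second when they are removed from the larger
    partition.\<close>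
  then have i: "i < largest_part (Q + replicate_mset j i)" using assms by linarith
  then have "largest_part (Q + replicate_mset j i) \<in># Q + replicate_mset j i"
    by (intro largest_part_in) simp
  \<comment> \<open>A part greater than \<open>i\<close> is not one of the added copies.\<close>
  with i have "largest_part (Q + replicate_mset j i) \<in># Q"
    by (auto split: if_splits)
  then show "largest_part (Q + replicate_mset j i) \<le> largest_part Q"
    using largest_part_le_iff by blast
qed

lemma f_coeff_eq_card: "f_coeff k N = int (card {Q \<in> partitions k. N < largest_part Q})"
proof -
  have "partitions k = {Q \<in> partitions k. \<forall>x\<in>#Q. x \<le> N} \<union> {Q \<in> partitions k. N < largest_part Q}"
    by (auto simp flip: largest_part_le_iff)
  then have "card (partitions k) =
      card ({Q \<in> partitions k. \<forall>x\<in>#Q. x \<le> N} \<union> {Q \<in> partitions k. N < largest_part Q})"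
    by (rule arg_cong)
  also have "\<dots> = card {Q \<in> partitions k. \<forall>x\<in>#Q. x \<le> N} + card {Q \<in> partitions k. N < largest_part Q}"
    by (rule card_Un_disjoint) (auto simp: finite_partitions simp flip: largest_part_le_iff)
  finally show ?thesis by (simp add: f_coeff_def num_partitions_def)
qed

text \<open>Divisors together with their cofactors, since the cofactor \<open>j\<close> serves as a
  number of copies of \<open>i\<close>. The additive equation leaves the set empty for
  \<open>n \<le> k\<close>, where \<open>g_coeff\<close> is \<open>0\<close> by convention.\<close>

definition factor_pairs :: "nat \<Rightarrow> nat \<Rightarrow> nat \<Rightarrow> (nat \<times> nat) set" where
  "factor_pairs n k N = {(i, j). 1 \<le> i \<and> i \<le> N \<and> 1 \<le> j \<and> k + i * j = n}"

lemma factor_pairs_subset: "factor_pairs n k N \<subseteq> {1..n} \<times> {1..n}"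
proof -
  have "i \<le> k + i * j \<and> j \<le> k + i * j" if "1 \<le> i" "1 \<le> j" for i j :: nat
    using that by (cases i; cases j) auto
  then show ?thesis by (auto simp: factor_pairs_def)
qed

lemma g_coeff_eq_card: "g_coeff (int n - int k) N = card (factor_pairs n k N)"
proof (cases "k < n")
  case True
  have "g_coeff (int n - int k) N = card {d. 1 \<le> d \<and> d \<le> N \<and> d dvd n - k}"
    using True by (simp add: g_coeff_def flip: of_nat_diff)
  also have "bij_betw (\<lambda>d. (d, (n - k) div d)) {d. 1 \<le> d \<and> d \<le> N \<and> d dvd n - k} (factor_pairs n k N)"
    using True
    by (intro bij_betw_byWitness[where f' = fst])
       (auto simp: factor_pairs_def div_greater_zero_iff Suc_le_eq dvd_imp_le)
  then have "card {d. 1 \<le> d \<and> d \<le> N \<and> d dvd n - k} = card (factor_pairs n k N)"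
    by (rule bij_betw_same_card)
  finally show ?thesis .
next
  case False
  then have "factor_pairs n k N = {}" by (auto simp: factor_pairs_def)
  with False show ?thesis by (simp add: g_coeff_def)
qed

lemma sum_mset_image_eq_sum_count:
  fixes h :: "'a \<Rightarrow> nat"
  assumes "finite A" "set_mset P \<subseteq> A"
  shows "(\<Sum>x\<in>#P. h x) = (\<Sum>i\<in>A. count P i * h i)"
  using assms(2)
proof (induction P)
  case (add x P)
  have "(\<Sum>i\<in>A. count (add_mset x P) i * h i) = (\<Sum>i\<in>A. count P i * h i + (if i = x then h i else 0))"
    by (rule sum.cong) auto
  also have "\<dots> = (\<Sum>i\<in>A. count P i * h i) + h x"
    using add.prems assms(1) by (simp add: sum.distrib)
  finally show ?case using add by simp
qed simp

text \<open>Both sides count the cells of the bounding rectangle of the Ferrers diagram.\<close>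

lemma sum_gaps_add_size_eq_bounding_rectangle:
  assumes "P \<in> partitions n"
  shows "(\<Sum>i=1..n. count P i * (largest_part P - i)) + n = largest_part P * size P"
proof -
  have "x \<in> {1..n}" if "x \<in># P" for x
    using that assms partition_bounds(2)[OF assms that] by (cases x) (auto simp: partitions_def)
  then have sub: "set_mset P \<subseteq> {1..n}" by blast
  \<comment> \<open>The bound \<open>L\<close> is kept fixed, since the largest part would change
    during the induction on \<open>P\<close>.\<close>
  have "(\<Sum>x\<in>#P. L - x) + sum_mset P = L * size P" if "\<forall>x\<in>#P. x \<le> L" for L
    using that by (induction P) auto
  then have "(\<Sum>x\<in>#P. largest_part P - x) + sum_mset P = largest_part P * size P"
    using largest_part_le_iff by blast
  then show ?thesis
    using assms sum_mset_image_eq_sum_count[OF _ sub, of "\<lambda>x. largest_part P - x"]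
    by (simp add: partitions_def)
qed

lemma sum_f_coeff_g_coeff:
  "(\<Sum>N=1..n. \<Sum>k\<le>n. f_coeff k N * int (g_coeff (int n - int k) N)) =
    (\<Sum>P\<in>partitions n. int (largest_part P * size P) - int n)"
proof -
  \<comment> \<open>\<open>?X\<close> collects what the products of \<open>f_coeff\<close> and
    \<open>g_coeff\<close> count, \<open>?Y\<close> the quadruples over the partitions of
    \<open>n\<close>.\<close>
  let ?X = "SIGMA N:{1..n}. SIGMA k:{..n}. {Q \<in> partitions k. N < largest_part Q} \<times> factor_pairs n k N"
  let ?Y = "SIGMA P:partitions n. SIGMA i:{1..n}. {1..count P i} \<times> {i..<largest_part P}"
  have fin: "finite (factor_pairs n k N)" for k N
    by (rule finite_subset[OF factor_pairs_subset]) simp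
  have "bij_betw (\<lambda>(N, k, Q, i, j). (Q + replicate_mset j i, i, j, N)) ?X ?Y"
  proof (rule bij_betw_byWitness[where f' = "\<lambda>(P, i, j, N). (N, n - i * j, P - replicate_mset j i, i, j)"],
      goal_cases)
    case 1
    show ?case by (auto simp: factor_pairs_def)
  next
    case 2
    show ?case by (auto simp: count_le_replicate_mset_subset_eq)
  next
    case 3
    have "Q + replicate_mset j i \<in> partitions n \<and> i \<in> {1..n} \<and> j \<in> {1..count (Q + replicate_mset j i) i}
        \<and> N \<in> {i..<largest_part (Q + replicate_mset j i)}"
      if Q: "Q \<in> partitions k" "N < largest_part Q" and ij: "(i, j) \<in> factor_pairs n k N" for N k Q i j
    proof -
      have "i \<le> N" "i \<in> {1..n}" "1 \<le> j" "k + i * j = n"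
        using ij factor_pairs_subset[of n k N] by (auto simp: factor_pairs_def simp del: One_nat_def)
      then show ?thesis using Q largest_part_add_replicate[of i Q j]
        by (auto simp: partitions_def in_replicate_mset sum_mset_replicate_mset)
    qed
    then show ?case by fastforce
  next
    case 4
    have "N \<in> {1..n} \<and> n - i * j \<in> {..n} \<and> P - replicate_mset j i \<in> partitions (n - i * j)
        \<and> N < largest_part (P - replicate_mset j i) \<and> (i, j) \<in> factor_pairs n (n - i * j) N"
      if P: "P \<in> partitions n" and ij: "i \<in> {1..n}" "j \<in> {1..count P i}"
        and N: "N \<in> {i..<largest_part P}" for N P i j
    proof -
      have "replicate_mset j i \<subseteq># P" using ij by (simp add: count_le_replicate_mset_subset_eq)
      then obtain Q where Q: "P = Q + replicate_mset j i"
        by (metis subset_mset.diff_add)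
      have "largest_part P \<le> n" using partition_bounds(2)[OF P] largest_part_le_iff by blast
      moreover have "largest_part P = largest_part Q"
        unfolding Q using N Q by (intro largest_part_add_replicate) auto
      moreover have "sum_mset Q + j * i = n" "0 \<notin># Q"
        using P unfolding Q by (auto simp: partitions_def sum_mset_replicate_mset)
      ultimately show ?thesis using ij N
        by (auto simp: partitions_def factor_pairs_def mult.commute Q)
    qed
    then show ?case by fastforce
  qed
  then have "card ?X = card ?Y" by (rule bij_betw_same_card)
  moreover have "int (card ?X) = (\<Sum>N=1..n. \<Sum>k\<le>n. f_coeff k N * int (g_coeff (int n - int k) N))"
    by (simp add: card_SigmaI fin finite_partitions f_coeff_eq_card g_coeff_eq_card card_cartesian_product)
  \<comment> \<open>For fixed \<open>P\<close> and \<open>i\<close> there are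
    \<open>count P i * (largest_part P - i)\<close> choices of \<open>(j, N)\<close>; the bounding
    rectangle evaluates their sum over \<open>i\<close>.\<close>
  moreover have "int (card ?Y) = (\<Sum>P\<in>partitions n. int (largest_part P * size P) - int n)"
    by (simp add: card_SigmaI finite_partitions card_cartesian_product
        flip: sum_gaps_add_size_eq_bounding_rectangle)
  ultimately show ?thesis by simp
qed

text \<open>A nonzero term requires \<open>N < k < n\<close>, so both sums can be cut off at
  \<open>n\<close>, and the index \<open>k = 0\<close> can be included at no cost.\<close>

lemma S_sum_eq:
  "S_sum n = (\<Sum>N=1..n. \<Sum>k\<le>n. f_coeff k N * int (g_coeff (int n - int k) N))"
proof -
  have inner: "(\<Sum>\<^sub>\<infinity>N\<in>{1..}. f_coeff k N * int (g_coeff (int n - int k) N)) =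
      (\<Sum>N=1..n. f_coeff k N * int (g_coeff (int n - int k) N))" for k
  proof -
    have "(\<Sum>\<^sub>\<infinity>N\<in>{1..}. f_coeff k N * int (g_coeff (int n - int k) N)) =
        (\<Sum>\<^sub>\<infinity>N\<in>{1..n}. f_coeff k N * int (g_coeff (int n - int k) N))"
    proof (rule infsum_cong_neutral)
      fix N assume "N \<in> {1..} - {1..n}"
      then have "n < N" by auto
      then show "f_coeff k N * int (g_coeff (int n - int k) N) = 0"
        by (cases "k \<le> N") (auto simp: f_coeff_eq_0 g_coeff_eq_0)
    qed auto
    then show ?thesis by simp
  qed
  have "S_sum n = (\<Sum>\<^sub>\<infinity>k\<in>{..n}. \<Sum>N=1..n. f_coeff k N * int (g_coeff (int n - int k) N))"
    unfolding S_sum_def inner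
    by (rule infsum_cong_neutral) (auto simp: f_coeff_eq_0 g_coeff_eq_0 not_less_eq_eq)
  also have "\<dots> = (\<Sum>k\<le>n. \<Sum>N=1..n. f_coeff k N * int (g_coeff (int n - int k) N))"
    by simp
  also have "\<dots> = (\<Sum>N=1..n. \<Sum>k\<le>n. f_coeff k N * int (g_coeff (int n - int k) N))"
    by (rule sum.swap)
  finally show ?thesis .
qed

lemma S_sum_eq_moments:
  "(of_int (S_sum n) :: rat) = of_nat (parts_moment2 n) - of_nat n * of_nat (num_partitions n)
    - 1 / 2 * of_int (rank_moment2 n)"
proof -
  have "S_sum n = (\<Sum>P\<in>partitions n. int (largest_part P * size P)) - int n * int (num_partitions n)"
    unfolding S_sum_eq sum_f_coeff_g_coeff by (simp add: sum_subtractf num_partitions_def)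
  \<comment> \<open>Doubling keeps the identity within the integers; the half appears only over the
    rationals.\<close>
  then have "2 * S_sum n = 2 * int (parts_moment2 n) - 2 * int n * int (num_partitions n) - rank_moment2 n"
    unfolding rank_moment2_conv_parts_moment2 by simp
  then have "(of_int (2 * S_sum n) :: rat) =
      of_int (2 * int (parts_moment2 n) - 2 * int n * int (num_partitions n) - rank_moment2 n)"
    by (rule arg_cong)
  then show ?thesis by (simp add: field_simps)
qed


section \<open>Generating functions of partitions and Euler's product\<close>

abbreviation bounded_partitions :: "nat \<Rightarrow> nat \<Rightarrow> nat multiset set" where
  "bounded_partitions N k \<equiv> {P \<in> partitions k. \<forall>x\<in>#P. x \<le> N}"

text \<open>Partitions are split by whether \<open>Suc N\<close> occurs; if it does, one copy is
  removed.\<close>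

lemma card_bounded_partitions_Suc:
  "card (bounded_partitions (Suc N) k) = card (bounded_partitions N k) +
    (if k < Suc N then 0 else card (bounded_partitions (Suc N) (k - Suc N)))"
proof -
  let ?A = "{P \<in> bounded_partitions (Suc N) k. Suc N \<in># P}"
  have "bounded_partitions (Suc N) k = bounded_partitions N k \<union> ?A"
    by (auto simp: le_Suc_eq)
  then have "card (bounded_partitions (Suc N) k) = card (bounded_partitions N k \<union> ?A)"
    by (rule arg_cong)
  also have "\<dots> = card (bounded_partitions N k) + card ?A"
    by (rule card_Un_disjoint) (auto simp: finite_partitions)
  also have "card ?A = (if k < Suc N then 0 else card (bounded_partitions (Suc N) (k - Suc N)))"
  proof (cases "k < Suc N")
    case True
    have "?A = {}"
      using True partition_bounds(2)[of _ k "Suc N"] by auto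
    with True show ?thesis by (simp only: card.empty if_True)
  next
    case False
    have "bij_betw (add_mset (Suc N)) (bounded_partitions (Suc N) (k - Suc N)) ?A"
    proof (rule bij_betw_imageI)
      show "add_mset (Suc N) ` bounded_partitions (Suc N) (k - Suc N) = ?A"
      proof (intro equalityI subsetI)
        fix P assume P: "P \<in> ?A"
        then obtain Q where Q: "P = add_mset (Suc N) Q" by (auto dest: mset_add)
        have "Q \<in> bounded_partitions (Suc N) (k - Suc N)"
          using P unfolding Q by (auto simp: partitions_def)
        then show "P \<in> add_mset (Suc N) ` bounded_partitions (Suc N) (k - Suc N)"
          unfolding Q by (rule imageI)
      qed (use False in \<open>auto simp: partitions_def\<close>)
    qed (auto intro: inj_onI)
    with False show ?thesis by (simp add: bij_betw_same_card)
  qed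
  finally show ?thesis .
qed

lemma card_bounded_partitions_0: "card (bounded_partitions 0 k) = (if k = 0 then 1 else 0)"
proof -
  have "P \<in> bounded_partitions 0 k \<longleftrightarrow> P \<in> (if k = 0 then {{#}} else {})" for P
    by (cases P) (auto simp: partitions_def)
  then have "bounded_partitions 0 k = (if k = 0 then {{#}} else {})"
    by (rule set_eqI)
  then show ?thesis by (simp only: split: if_split) simp
qed

lemma bounded_partitions_eq_partitions: "k \<le> N \<Longrightarrow> bounded_partitions N k = partitions k"
  using partition_bounds(2) order_trans by blast

lemma fps_mult_one_minus_X_power_nth:
  fixes A :: "'a::comm_ring_1 fps"
  shows "(A * (1 - fps_X ^ i)) $ n = A $ n - (if n < i then 0 else A $ (n - i))"
  by (simp add: right_diff_distrib fps_X_power_mult_right_nth)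

definition bounded_partitions_fps :: "nat \<Rightarrow> rat fps" where
  "bounded_partitions_fps N = Abs_fps (\<lambda>k. of_nat (card (bounded_partitions N k)))"

definition partitions_fps :: "rat fps" where
  "partitions_fps = Abs_fps (\<lambda>k. of_nat (num_partitions k))"

text \<open>Euler's product in division-free form: by the recursion above, the factor
  \<open>1 - fps_X ^ Suc N\<close>, the last one of \<open>qpoch fps_X fps_X (Suc N)\<close>, lowers
  the bound on the parts by one.\<close>

lemma bounded_partitions_fps_mult_qpoch: "bounded_partitions_fps N * qpoch fps_X fps_X N = 1"
proof (induction N)
  case 0
  show ?case
    by (rule fps_ext) (simp add: bounded_partitions_fps_def qpoch_def card_bounded_partitions_0 del: le_zero_eq)
next
  case (Suc N)
  have "bounded_partitions_fps (Suc N) * (1 - fps_X ^ Suc N) = bounded_partitions_fps N"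
    by (rule fps_ext)
       (simp only: fps_mult_one_minus_X_power_nth, simp add: bounded_partitions_fps_def card_bounded_partitions_Suc)
  moreover have "qpoch fps_X fps_X (Suc N) = (1 - fps_X ^ Suc N) * (qpoch fps_X fps_X N :: rat fps)"
    by (simp add: qpoch_def mult.commute)
  ultimately show ?case
    using Suc by (simp only: mult.assoc[symmetric])
qed

lemma partitions_fps_nth_0: "partitions_fps $ 0 = 1"
  using card_bounded_partitions_0[of 0]
  by (simp add: partitions_fps_def num_partitions_def bounded_partitions_eq_partitions del: le_zero_eq)

text \<open>Coefficient \<open>m\<close> is constant from \<open>n = m\<close> on: the difference of
  the two series is a multiple of \<open>partitions_fps - bounded_partitions_fps n\<close>, whose
  coefficients vanish up to degree \<open>n\<close>.\<close>

lemma tendsto_qpoch: "qpoch fps_X fps_X \<longlonglongrightarrow> inverse partitions_fps"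
proof (rule tendsto_fpsI)
  fix m
  have "qpoch fps_X fps_X n $ m = inverse partitions_fps $ m" if "m \<le> n" for n
  proof -
    let ?Q = "qpoch fps_X fps_X n" and ?I = "inverse partitions_fps"
    have I: "?I * partitions_fps = 1"
      by (rule inverse_mult_eq_1) (simp add: partitions_fps_nth_0)
    have "?Q - ?I = ?Q * (?I * partitions_fps) - ?I * (bounded_partitions_fps n * ?Q)"
      by (simp add: I bounded_partitions_fps_mult_qpoch)
    also have "\<dots> = (?Q * ?I) * (partitions_fps - bounded_partitions_fps n)"
      by (simp add: algebra_simps)
    finally have "(?Q - ?I) $ m = ((?Q * ?I) * (partitions_fps - bounded_partitions_fps n)) $ m"
      by simp
    also have "\<dots> = 0"
      unfolding fps_mult_nth[of "?Q * ?I"] using that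
      by (intro sum.neutral)
         (simp add: partitions_fps_def bounded_partitions_fps_def num_partitions_def bounded_partitions_eq_partitions)
    finally show ?thesis by simp
  qed
  then show "\<forall>\<^sub>F n in sequentially. qpoch fps_X fps_X n $ m = inverse partitions_fps $ m"
    by (auto simp: eventually_sequentially)
qed

lemma qpoch_inf_eq: "qpoch_inf fps_X fps_X = inverse partitions_fps"
proof -
  \<comment> \<open>Convergence of an infinite product requires a nonzero limit of the partial
    products.\<close>
  have "inverse partitions_fps \<noteq> 0"
    by (simp add: partitions_fps_nth_0 fps_eq_iff exI[of _ 0])
  \<comment> \<open>The partial products here include the factor of index \<open>n\<close>, hence
    the shift by one.\<close>
  moreover have "(\<lambda>n. \<Prod>i\<le>n. 1 - fps_X * fps_X ^ i) \<longlonglongrightarrow> inverse partitions_fps"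
    using LIMSEQ_Suc[OF tendsto_qpoch] by (simp only: qpoch_def lessThan_Suc_atMost)
  ultimately have "(\<lambda>k. 1 - fps_X * fps_X ^ k) has_prod inverse partitions_fps"
    by (simp add: has_prod_def raw_has_prod_def)
  then show ?thesis unfolding qpoch_inf_def by (rule has_prod_unique[symmetric])
qed

lemma div_qpoch_nth:
  "(1 / qpoch_inf fps_X fps_X - 1 / qpoch fps_X fps_X N :: rat fps) $ k = of_int (f_coeff k N)"
proof -
  \<comment> \<open>Cancelling in a quotient requires a nonzero denominator, which
    \<open>A * B = 1\<close> provides.\<close>
  have div: "1 / B = A" if "A * B = 1" for A B :: "rat fps"
    using that nonzero_mult_div_cancel_right[of B A] by (metis mult_zero_right zero_neq_one)
  have "partitions_fps * qpoch_inf fps_X fps_X = 1"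
    unfolding qpoch_inf_eq by (rule inverse_mult_eq_1') (simp add: partitions_fps_nth_0)
  from div[OF this] div[OF bounded_partitions_fps_mult_qpoch[of N]] show ?thesis
    by (simp add: f_coeff_def partitions_fps_def bounded_partitions_fps_def)
qed

section \<open>Coefficients of the divisor sums\<close>

lemma X_power_div_one_minus_X_power_nth:
  assumes "1 \<le> i"
  shows "(fps_X ^ i / (1 - fps_X ^ i) :: rat fps) $ m = (if 1 \<le> m \<and> i dvd m then 1 else 0)"
proof -
  \<comment> \<open>The geometric series without its constant term; \<open>1 \<le> m\<close> is
    needed because \<open>i\<close> divides \<open>0\<close>.\<close>
  let ?G = "Abs_fps (\<lambda>m. if 1 \<le> m \<and> i dvd m then 1 else 0) :: rat fps"
  have "?G * (1 - fps_X ^ i) = fps_X ^ i"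
  proof (rule fps_ext)
    fix n
    show "(?G * (1 - fps_X ^ i)) $ n = (fps_X ^ i :: rat fps) $ n"
      unfolding fps_mult_one_minus_X_power_nth using assms
      by (auto simp: dvd_minus_self dest: dvd_imp_le)
  qed
  moreover have "(1 - fps_X ^ i :: rat fps) $ 0 \<noteq> 0" using assms by simp
  then have "(1 - fps_X ^ i :: rat fps) \<noteq> 0" by (metis fps_zero_nth)
  ultimately have "fps_X ^ i / (1 - fps_X ^ i) = ?G"
    by (metis nonzero_mult_div_cancel_right)
  then show ?thesis by simp
qed

lemma sum_X_power_div_nth:
  "(\<Sum>i=1..N. fps_X ^ i / (1 - fps_X ^ i) :: rat fps) $ m = of_nat (g_coeff (int m) N)"
proof -
  have "(\<Sum>i=1..N. fps_X ^ i / (1 - fps_X ^ i) :: rat fps) $ m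
      = (\<Sum>i=1..N. if 1 \<le> m \<and> i dvd m then 1 else 0)"
    unfolding fps_sum_nth
    by (intro sum.cong refl X_power_div_one_minus_X_power_nth) simp
  also have "\<dots> = of_nat (card {i \<in> {1..N}. 1 \<le> m \<and> i dvd m})"
    by (simp flip: sum.inter_filter)
  also have "card {i \<in> {1..N}. 1 \<le> m \<and> i dvd m} = g_coeff (int m) N"
    by (auto simp: g_coeff_def intro!: arg_cong[where f = card])
  finally show ?thesis .
qed

section \<open>Summation in the q-adic metric\<close>

lemma has_sum_fpsI:
  fixes F :: "nat \<Rightarrow> 'a::ab_group_add fps"
  assumes "\<And>m N. m < N \<Longrightarrow> F N $ m = 0"
  shows "(F has_sum Abs_fps (\<lambda>m. \<Sum>N=1..m. F N $ m)) {1..}"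
  unfolding has_sum_def
proof (rule tendsto_fpsI)
  fix m
  \<comment> \<open>Indices above \<open>m\<close> do not affect coefficient \<open>m\<close>, so
    all finite index sets containing \<open>{1..m}\<close> agree there.\<close>
  have "sum F Y $ m = (\<Sum>N=1..m. F N $ m)" if "finite Y" "{1..m} \<subseteq> Y" "Y \<subseteq> {1..}" for Y
    unfolding fps_sum_nth
    using that assms by (intro sum.mono_neutral_right) (auto simp: subset_iff not_le)
  then show "\<forall>\<^sub>F Y in finite_subsets_at_top {1..}.
      sum F Y $ m = Abs_fps (\<lambda>m. \<Sum>N=1..m. F N $ m) $ m"
    unfolding eventually_finite_subsets_at_top by (intro exI[of _ "{1..m}"]) simp
qed

theorem theorem1p1:
  fixes q :: "rat fps" and F :: "nat \<Rightarrow> rat fps"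
  defines "q \<equiv> fps_X"
  defines "F \<equiv> \<lambda>n. (1 / qpoch_inf q q - 1 / qpoch q q n) * (\<Sum>i=1..n. q ^ i / (1 - q ^ i))"
  shows "F summable_on {1..} \<and>
    Abs_fps (\<lambda>n. if n \<ge> 1 then of_int (S_sum n) else 0) = (\<Sum>\<^sub>\<infinity>n\<in>{1..}. F n) \<and>
    (\<Sum>\<^sub>\<infinity>n\<in>{1..}. F n) =
      Abs_fps (\<lambda>n. if n \<ge> 1
        then of_nat (parts_moment2 n) - of_nat n * of_nat (num_partitions n)
          - 1 / 2 * of_int (rank_moment2 n)
        else 0)"
proof -
  have F_nth: "F N $ m = of_int (\<Sum>k\<le>m. f_coeff k N * int (g_coeff (int m - int k) N))" for N m
    unfolding F_def q_def fps_mult_nth div_qpoch_nth sum_X_power_div_nth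
    by (simp add: atMost_atLeast0 of_nat_diff)
  \<comment> \<open>Every \<open>k\<close> in the Cauchy product satisfies
    \<open>k \<le> m < N\<close>, where \<open>f_coeff k N\<close> vanishes.\<close>
  have "F N $ m = 0" if "m < N" for m N
    using that by (simp add: F_nth f_coeff_eq_0)
  then have "(F has_sum Abs_fps (\<lambda>m. \<Sum>N=1..m. F N $ m)) {1..}"
    by (rule has_sum_fpsI)
  \<comment> \<open>At \<open>m = 0\<close> the sum is empty, in agreement with the value
    \<open>0\<close> prescribed there.\<close>
  also have "(\<lambda>m. \<Sum>N=1..m. F N $ m) = (\<lambda>m. if m \<ge> 1 then of_int (S_sum m) else 0)"
    by (auto simp: F_nth S_sum_eq)
  finally have "(F has_sum Abs_fps (\<lambda>n. if n \<ge> 1 then of_int (S_sum n) else 0)) {1..}" .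
  then show ?thesis
    by (auto simp: summable_on_def infsumI S_sum_eq_moments cong: if_cong)
qed

end
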